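(* Let $k$ be a positive integer. Then for all $1 \leq i \leq k-1$, the exponential growth rate of the distant pattern $D_i = 1\cdots i\,\square\,(i+1)\cdots k$ satisfies $$(k-1)^2 \;\leq\; L(D_i) \;\leq\; (k-1)^2+1 .$$
   Context: Permutations are written in one-line notation. The distant pattern $D_i = 1\cdots i\,\square\,(i+1)\cdots k$ is avoided by a permutation $p=p_1\cdots p_n\in\mathfrak{S}_n$ if there are no indices $a_1<a_2<\dots<a_k$ with $p_{a_1}<p_{a_2}<\dots<p_{a_k}$ and $a_{i+1}-a_i\ge 2$ (i.e., there is no increasing subsequence of length $k$ whose $i$-th and $(i+1)$-st entries are in non-adjacent positions). Equivalently, $p$ avoids, as classical patterns, all $\pi\in\mathfrak{S}_{k+1}$ such that deleting the entry in position $i+1$ from $\pi$ leaves an increasing word. $\mathrm{Av}_n(D_i)$ denotes the set of permutations in $\mathfrak{S}_n$ avoiding $D_i$. The exponential growth rate is $L(D_i)=\lim_{n\to\infty}|\mathrm{Av}_n(D_i)|^{1/n}$. *)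

theory Defs
  imports Complex_Main "HOL-Library.FuncSet" "HOL-Combinatorics.Permutations"
begin

text \<open>
  A permutation with one-line notation \<open>p\<^sub>1 \<cdots> p\<^sub>n\<close> is a function
  \<open>p permutes {1..n}\<close> with \<open>p\<^sub>j = p j\<close>.  The distant pattern
  \<open>D\<^sub>i = 1 \<cdots> i \<box> (i+1) \<cdots> k\<close> depends on \<open>k\<close> and \<open>i\<close>, which are both parameters below;
  \<open>a 1 < \<dots> < a k\<close> are the positions of an occurrence.
\<close>

definition contains_distant :: "nat \<Rightarrow> nat \<Rightarrow> nat \<Rightarrow> (nat \<Rightarrow> nat) \<Rightarrow> bool" where
  "contains_distant k i n p \<longleftrightarrow>
     (\<exists>a :: nat \<Rightarrow> nat. a \<in> {1..k} \<rightarrow> {1..n} \<and>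
        strict_mono_on {1..k} a \<and>
        strict_mono_on {1..k} (\<lambda>j. p (a j)) \<and>
        a i + 2 \<le> a (i + 1))"

definition Av :: "nat \<Rightarrow> nat \<Rightarrow> nat \<Rightarrow> (nat \<Rightarrow> nat) set" where
  "Av k i n = {p. p permutes {1..n} \<and> \<not> contains_distant k i n p}"

definition growth_rate :: "nat \<Rightarrow> nat \<Rightarrow> real" where
  "growth_rate k i = lim (\<lambda>n. root n (real (card (Av k i n))))"

end

theory Submission
  imports Defs "HOL-Combinatorics.Multiset_Permutations"
begin

text \<open>
  Put \<open>m = k - 1\<close>, and let \<open>E x\<close> and \<open>S x\<close> measure the longest increasing subsequences of \<open>p\<close> ending
  and starting at position \<open>x\<close>.  For \<open>p\<close> avoiding \<open>D\<^sub>i\<close>, color \<open>x\<close> by \<open>E x\<close> when this is small and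
  by \<open>k - S x\<close> (cut off at \<open>i\<close>) otherwise.  This uses \<open>m\<close> colors, and the only ascents inside a color
  class are between adjacent positions of color \<open>i\<close>.  Hence \<open>p\<close> is determined by the word of colors of its
  values and the word of colors of its positions in which the left end of every such ascent is
  replaced by a new letter.  As that letter is always followed by \<open>i\<close>, there are at most
  \<open>(m + 1/m)\<^sup>n\<close> position words, and so at most \<open>(m\<^sup>2 + 1)\<^sup>n\<close> permutations.

  Skew sums make the counting sequence supermultiplicative, so the limit exists and dominates every
  \<open>|Av\<^sub>n(D\<^sub>i)|\<^sup>1\<^sup>/\<^sup>n\<close>.  For the lower bound it therefore suffices to find, for some lengths \<open>n\<close>, about
  \<open>m\<^sup>2\<^sup>n\<close> permutations without increasing subsequence of length \<open>k\<close>.  Pairs of ballot words (standard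
  tableaux of rectangular shape with \<open>m\<close> rows) inject into these, and a long product of words in
  which all letters occur equally often becomes a ballot word after adding a ramp at both ends.
\<close>

section \<open>Upper bound\<close>

primrec chain :: "('a \<Rightarrow> 'a \<Rightarrow> bool) \<Rightarrow> nat \<Rightarrow> 'a \<Rightarrow> bool" where
  "chain R 0 x \<longleftrightarrow> True"
| "chain R (Suc j) x \<longleftrightarrow> (\<exists>z. R x z \<and> chain R j z)"

definition height :: "('a \<Rightarrow> 'a \<Rightarrow> bool) \<Rightarrow> 'a \<Rightarrow> nat" where
  "height R x = (GREATEST j. chain R j x)"

lemma chain_Suc_imp: "chain R (Suc j) x \<Longrightarrow> chain R j x"
  by (induction j arbitrary: x) auto

lemma chain_antimono: "j \<le> j' \<Longrightarrow> chain R j' x \<Longrightarrow> chain R j x"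
  by (induction rule: inc_induct) (auto dest: chain_Suc_imp simp del: chain.simps)

lemma chain_le_measure:
  assumes "\<And>x z. R x z \<Longrightarrow> f z < (f x :: nat)" and "chain R j x"
  shows "j \<le> f x"
  using assms(2)
proof (induction j arbitrary: x)
  case (Suc j)
  then obtain z where "R x z" "chain R j z" by auto
  with Suc.IH[of z] assms(1)[of x z] show ?case by simp
qed simp

text \<open>The decreasing measure \<open>f\<close> bounds the length of every chain from
  \<open>x\<close>, so the \<open>GREATEST\<close> in \<open>height\<close> is attained; truncating
  a longest chain gives all smaller lengths.\<close>

lemma chain_iff_le_height:
  assumes "\<And>x z. R x z \<Longrightarrow> f z < (f x :: nat)"
  shows "chain R j x \<longleftrightarrow> j \<le> height R x"
proof -
  have bound: "chain R j x \<Longrightarrow> j \<le> f x" for j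
    using chain_le_measure[of R f j x] assms by blast
  have "chain R (height R x) x"
    unfolding height_def by (rule GreatestI_nat[of _ 0 "f x"]) (use bound in auto)
  moreover have "chain R j x \<Longrightarrow> j \<le> height R x" for j
    unfolding height_def by (rule Greatest_le_nat[of _ _ "f x"]) (use bound in auto)
  ultimately show ?thesis
    using chain_antimono by metis
qed

lemma height_less:
  assumes "\<And>x z. R x z \<Longrightarrow> f z < (f x :: nat)" and "R x z"
  shows "height R z < height R x"
proof -
  have "chain R (height R z) z" using chain_iff_le_height[of R f] assms(1) by blast
  with assms(2) have "chain R (Suc (height R z)) x" by auto
  then show ?thesis using chain_iff_le_height[of R f] assms(1) Suc_le_eq by blast
qed

section \<open>Increasing subsequences ending or starting at a given position\<close>

definition below :: "(nat \<Rightarrow> nat) \<Rightarrow> nat \<Rightarrow> nat \<Rightarrow> bool" where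
  "below p x z \<longleftrightarrow> 1 \<le> z \<and> z < x \<and> p z < p x"

text \<open>\<open>below\<close> only imposes the lower end of \<open>{1..n}\<close> and
  \<open>above\<close> only the upper end: a walk that starts inside cannot leave on the other
  side.\<close>

definition above :: "nat \<Rightarrow> (nat \<Rightarrow> nat) \<Rightarrow> nat \<Rightarrow> nat \<Rightarrow> bool" where
  "above n p x z \<longleftrightarrow> z \<le> n \<and> x < z \<and> p x < p z"

lemma chain_below_iff: "chain (below p) j x \<longleftrightarrow> j \<le> height (below p) x"
  by (rule chain_iff_le_height[of _ "\<lambda>x. x"]) (simp add: below_def)

lemma chain_above_iff: "chain (above n p) j x \<longleftrightarrow> j \<le> height (above n p) x"
  by (rule chain_iff_le_height[of _ "\<lambda>x. n - x"]) (auto simp: above_def)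

lemma height_below_less: "below p x z \<Longrightarrow> height (below p) z < height (below p) x"
  by (rule height_less[of _ "\<lambda>x. x"]) (simp_all add: below_def)

lemma height_above_less: "above n p x z \<Longrightarrow> height (above n p) z < height (above n p) x"
  by (rule height_less[of _ "\<lambda>x. n - x"]) (auto simp: above_def)

lemma strict_mono_on_atLeastAtMostI:
  fixes f :: "nat \<Rightarrow> nat"
  assumes "\<And>t. u \<le> t \<Longrightarrow> t < v \<Longrightarrow> f t < f (Suc t)"
  shows "strict_mono_on {u..v} f"
proof (rule strict_mono_onI)
  fix r s assume "r \<in> {u..v}" "s \<in> {u..v}" "r < s"
  from \<open>r < s\<close> have "s \<le> v \<Longrightarrow> f r < f s"
  proof (induction s)
    case (Suc s)
    then show ?case using assms[of s] \<open>r \<in> {u..v}\<close> by (cases "r = s") auto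
  qed simp
  then show "f r < f s" using \<open>s \<in> {u..v}\<close> by simp
qed

lemma chain_below_seq:
  assumes "chain (below p) j x" and "x \<in> {1..n}"
  shows "\<exists>a. a (Suc j) = x \<and> (\<forall>t\<in>{1..Suc j}. a t \<in> {1..n}) \<and>
    (\<forall>t\<in>{1..j}. a t < a (Suc t) \<and> p (a t) < p (a (Suc t)))"
  using assms
proof (induction j arbitrary: x)
  case 0
  then show ?case by (intro exI[of _ "\<lambda>_. x"]) auto
next
  case (Suc j)
  then obtain z where z: "below p x z" "chain (below p) j z" by auto
  with Suc.prems have "z \<in> {1..n}" by (auto simp: below_def)
  from Suc.IH[OF z(2) this] obtain a where "a (Suc j) = z"
    "\<forall>t\<in>{1..Suc j}. a t \<in> {1..n}"
    "\<forall>t\<in>{1..j}. a t < a (Suc t) \<and> p (a t) < p (a (Suc t))" by blast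
  then show ?case using z(1) Suc.prems
    by (intro exI[of _ "a(Suc (Suc j) := x)"]) (auto simp: below_def le_Suc_eq)
qed

text \<open>The free start index \<open>s\<close> allows the sequence to be glued behind one that
  ends at index \<open>i\<close>.\<close>

lemma chain_above_seq:
  assumes "chain (above n p) j x" and "x \<in> {1..n}"
  shows "\<exists>a. a s = x \<and> (\<forall>t\<in>{s..s+j}. a t \<in> {1..n}) \<and>
    (\<forall>t\<in>{s..<s+j}. a t < a (Suc t) \<and> p (a t) < p (a (Suc t)))"
  using assms
proof (induction j arbitrary: x s)
  case 0
  then show ?case by (intro exI[of _ "\<lambda>_. x"]) auto
next
  case (Suc j)
  then obtain z where z: "above n p x z" "chain (above n p) j z" by auto
  with Suc.prems have "z \<in> {1..n}" by (auto simp: above_def)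
  from Suc.IH[OF z(2) this, of "Suc s"] obtain a where a: "a (Suc s) = z"
    "\<And>t. t\<in>{Suc s..Suc s + j} \<Longrightarrow> a t \<in> {1..n}"
    "\<And>t. t\<in>{Suc s..<Suc s + j} \<Longrightarrow> a t < a (Suc t) \<and> p (a t) < p (a (Suc t))" by blast
  let ?a = "a(s := x)"
  have "?a t \<in> {1..n}" if "t \<in> {s..s + Suc j}" for t
    using a(2)[of t] that Suc.prems(2) by (cases "t = s") auto
  moreover have "?a t < ?a (Suc t) \<and> p (?a t) < p (?a (Suc t))" if "t \<in> {s..<s + Suc j}" for t
    using a(1) a(3)[of t] that z(1) by (cases "t = s") (auto simp: above_def)
  ultimately show ?case by (intro exI[of _ ?a]) auto
qed

text \<open>There are \<open>i - 1\<close> entries leading up to \<open>x\<close> and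
  \<open>k - 1 - i\<close> entries continuing from \<open>y\<close>. Together with \<open>x\<close>
  and \<open>y\<close> they form an occurrence whose gap lies between \<open>x\<close> and
  \<open>y\<close>.\<close>

lemma contains_distantI:
  assumes "1 \<le> i" "i < k" and x: "x \<in> {1..n}" and y: "y \<in> {1..n}"
    and xy: "x + 2 \<le> y" "p x < p y"
    and "i - 1 \<le> height (below p) x" and "k - 1 - i \<le> height (above n p) y"
  shows "contains_distant k i n p"
proof -
  have "chain (below p) (i - 1) x" "chain (above n p) (k - 1 - i) y"
    using assms by (simp_all add: chain_below_iff chain_above_iff)
  from chain_below_seq[OF this(1) x] obtain a where "a (Suc (i - 1)) = x"
      "\<forall>t\<in>{1..Suc (i - 1)}. a t \<in> {1..n}"
      "\<forall>t\<in>{1..i - 1}. a t < a (Suc t) \<and> p (a t) < p (a (Suc t))" by blast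
  then have a: "a i = x" "\<And>t. t\<in>{1..i} \<Longrightarrow> a t \<in> {1..n}"
      "\<And>t. t\<in>{1..<i} \<Longrightarrow> a t < a (Suc t) \<and> p (a t) < p (a (Suc t))"
    using assms(1) by auto
  from chain_above_seq[OF \<open>chain (above n p) (k - 1 - i) y\<close> y, of "Suc i"]
  obtain b where "b (Suc i) = y" "\<forall>t\<in>{Suc i..Suc i + (k - 1 - i)}. b t \<in> {1..n}"
      "\<forall>t\<in>{Suc i..<Suc i + (k - 1 - i)}. b t < b (Suc t) \<and> p (b t) < p (b (Suc t))" by blast
  then have b: "b (Suc i) = y" "\<And>t. t\<in>{Suc i..k} \<Longrightarrow> b t \<in> {1..n}"
      "\<And>t. t\<in>{Suc i..<k} \<Longrightarrow> b t < b (Suc t) \<and> p (b t) < p (b (Suc t))"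
    using assms(2) by simp_all
  let ?c = "\<lambda>t. if t \<le> i then a t else b t"
  have step: "?c t < ?c (Suc t) \<and> p (?c t) < p (?c (Suc t))" if "1 \<le> t" "t < k" for t
  proof (cases t i rule: linorder_cases)
    case less then show ?thesis using a(3)[of t] that by simp
  next
    case equal then show ?thesis using a(1) b(1) xy by simp
  next
    case greater then show ?thesis using b(3)[of t] that by simp
  qed
  have "?c \<in> {1..k} \<rightarrow> {1..n}" using a(2) b(2) by (auto simp: Pi_def)
  moreover have "strict_mono_on {1..k} ?c" "strict_mono_on {1..k} (\<lambda>t. p (?c t))"
    using step by (intro strict_mono_on_atLeastAtMostI; blast)+
  moreover have "?c i + 2 \<le> ?c (i + 1)" using a(1) b(1) xy by simp
  ultimately show ?thesis unfolding contains_distant_def by blast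
qed

text \<open>
  The heights are one less than the lengths of the subsequences, so colors start at \<open>0\<close> and the
  special color is \<open>i - 1\<close>.
\<close>

definition color :: "nat \<Rightarrow> nat \<Rightarrow> nat \<Rightarrow> (nat \<Rightarrow> nat) \<Rightarrow> nat \<Rightarrow> nat" where
  "color k i n p x = (if height (below p) x < i then height (below p) x
     else max (i - 1) (k - 2 - height (above n p) x))"

lemma color_less: "1 \<le> i \<Longrightarrow> i < k \<Longrightarrow> color k i n p x < k - 1"
  by (auto simp: color_def)

text \<open>Along an ascent the height from below grows strictly and the height from above drops
  strictly. Equal colors can therefore occur only at \<open>i - 1\<close>, where the two rules meet
  and the cut-off acts. There the height of \<open>x\<close> from below and that of \<open>y\<close>
  from above suffice for \<open>contains_distantI\<close>, unless \<open>x\<close> and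
  \<open>y\<close> are adjacent.\<close>

lemma same_color_ascent:
  assumes "1 \<le> i" "i < k" and avoid: "\<not> contains_distant k i n p"
    and xy: "x \<in> {1..n}" "y \<in> {1..n}" "x < y" "p x < p y"
    and eq: "color k i n p x = color k i n p y"
  shows "y = Suc x \<and> color k i n p x = i - 1"
proof -
  have E: "height (below p) x < height (below p) y"
    by (rule height_below_less) (use xy in \<open>auto simp: below_def\<close>)
  have S: "height (above n p) y < height (above n p) x"
    by (rule height_above_less) (use xy in \<open>auto simp: above_def\<close>)
  have "i - 1 \<le> height (below p) x" "k - 1 - i \<le> height (above n p) y" "color k i n p x = i - 1"
    using E S eq assms(1,2) unfolding color_def
    by (auto split: if_splits simp: max_def)
  moreover from this have "\<not> x + 2 \<le> y"
    using contains_distantI[OF assms(1,2) xy(1,2) _ xy(4)] avoid by blast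
  ultimately show ?thesis using xy by auto
qed

text \<open>The word of value colors fixes the set of values taken on each color class, and
  \<open>ord\<close> fixes their relative order. So the value at \<open>x\<close> is the element of
  a known set with a known number of larger elements.\<close>

lemma permutes_eqI_of_coloring:
  fixes p q :: "nat \<Rightarrow> nat"
  assumes p: "p permutes A" and q: "q permutes A" and "finite A"
    and val: "\<And>v. v \<in> A \<Longrightarrow> c (inv p v) = c (inv q v)"
    and ord: "\<And>x y. x \<in> A \<Longrightarrow> y \<in> A \<Longrightarrow> c x = c y \<Longrightarrow> p x < p y \<longleftrightarrow> q x < q y"
  shows "p = q"
proof (rule ext)
  fix x
  show "p x = q x"
  proof (cases "x \<in> A")
    case True
    define C where "C = {y\<in>A. c y = c x}"
    have img: "r ` C = {v\<in>A. c (inv r v) = c x}" if "r permutes A" for r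
    proof -
      have "v \<in> r ` C" if "v \<in> A" "c (inv r v) = c x" for v
        using that \<open>r permutes A\<close> unfolding C_def
        by (intro image_eqI[of _ _ "inv r v"])
           (auto simp: permutes_inverses permutes_in_image[OF permutes_inv])
      then show ?thesis
        using that by (auto simp: C_def permutes_inverses permutes_in_image)
    qed
    have imgs: "p ` C = q ` C" using img[OF p] img[OF q] val by auto
    have "card {v\<in>r ` C. r x < v} = card {y\<in>C. r x < r y}" if "r permutes A" for r
    proof -
      have "{v\<in>r ` C. r x < v} = r ` {y\<in>C. r x < r y}" by auto
      then show ?thesis by (simp add: card_image inj_on_subset[OF permutes_inj[OF that]])
    qed
    moreover have "{y\<in>C. p x < p y} = {y\<in>C. q x < q y}"
      using ord True by (auto simp: C_def)
    ultimately have eq: "card {v\<in>p ` C. p x < v} = card {v\<in>p ` C. q x < v}"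
      using p q imgs by metis
    have fin: "finite (p ` C)" and mem: "p x \<in> p ` C" "q x \<in> p ` C"
      using True \<open>finite A\<close> imgs by (auto simp: C_def)
    show ?thesis
    proof (cases "p x" "q x" rule: linorder_cases)
      case less
      then have "{v\<in>p ` C. q x < v} \<subset> {v\<in>p ` C. p x < v}" using mem by auto
      from psubset_card_mono[OF _ this] fin eq show ?thesis by simp
    next
      case greater
      then have "{v\<in>p ` C. p x < v} \<subset> {v\<in>p ` C. q x < v}" using mem by auto
      from psubset_card_mono[OF _ this] fin eq show ?thesis by simp
    qed simp
  qed (use p q in \<open>simp add: permutes_not_in\<close>)
qed

section \<open>Counting color words with marks\<close>

definition marked_words :: "nat \<Rightarrow> nat \<Rightarrow> nat \<Rightarrow> nat list set" where
  "marked_words m s n = {w. length w = n \<and> set w \<subseteq> {..m} \<and>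
     (\<forall>x<n. w ! x = m \<longrightarrow> Suc x < n \<and> w ! Suc x = s)}"

lemma finite_marked_words: "finite (marked_words m s n)"
  by (rule finite_subset[OF _ finite_lists_length_eq[of "{..m}" n]]) (auto simp: marked_words_def)

lemma marked_words_tl:
  assumes "c # w \<in> marked_words m s (Suc n)"
  shows "w \<in> marked_words m s n"
  using assms by (auto simp: marked_words_def)

text \<open>A word starts with an ordinary letter or with the pair \<open>m\<close>,
  \<open>s\<close>, so the counts satisfy a(n+2) \<le> m a(n+1) + a(n). The base \<mu> = m + 1/m
  works because \<mu>^2 = m \<mu> + 1 + 1/m^2, and it is chosen so that m \<mu> = m^2 + 1.\<close>

lemma card_marked_words_le:
  assumes "0 < m" "s < m"
  shows "real (card (marked_words m s n)) \<le> (real m + 1 / real m) ^ n"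
proof (induction n rule: induct_nat_012)
  case 0
  have "marked_words m s 0 \<subseteq> {[]}" by (auto simp: marked_words_def)
  from card_mono[OF _ this] show ?case by simp
next
  case 1
  have "marked_words m s 1 \<subseteq> (\<lambda>c. [c]) ` {..<m}"
    by (auto simp: marked_words_def length_Suc_conv image_iff nat_less_le)
  from card_mono[OF _ this] have "card (marked_words m s 1) \<le> m"
    using card_image_le[of "{..<m}" "\<lambda>c. [c]"] by simp
  then have "real (card (marked_words m s 1)) \<le> real m" by simp
  also have "\<dots> \<le> real m + 1 / real m" by simp
  finally show ?case by simp
next
  case (ge2 n)
  let ?W = "marked_words m s" and ?mu = "real m + 1 / real m"
  have "?W (Suc (Suc n)) \<subseteq> (\<lambda>(c, w). c # w) ` ({..<m} \<times> ?W (Suc n)) \<union> (\<lambda>w. m # s # w) ` ?W n"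
  proof
    fix w assume w: "w \<in> ?W (Suc (Suc n))"
    then have "length w = Suc (Suc n)" by (simp add: marked_words_def)
    then obtain c d u where cdu: "w = c # d # u" by (auto simp: length_Suc_conv)
    from w have t: "d # u \<in> ?W (Suc n)" "u \<in> ?W n" unfolding cdu
      by (blast dest: marked_words_tl)+
    from w have "c \<le> m" "c = m \<Longrightarrow> d = s" unfolding cdu
      by (auto simp: marked_words_def)
    then show "w \<in> (\<lambda>(c, w). c # w) ` ({..<m} \<times> ?W (Suc n)) \<union> (\<lambda>w. m # s # w) ` ?W n"
      using t unfolding cdu by (cases "c = m") (auto simp: image_iff)
  qed
  then have "card (?W (Suc (Suc n))) \<le>
      card ((\<lambda>(c, w). c # w) ` ({..<m} \<times> ?W (Suc n)) \<union> (\<lambda>w. m # s # w) ` ?W n)"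
    by (intro card_mono) (auto simp: finite_marked_words)
  also have "\<dots> \<le> card ((\<lambda>(c, w). c # w) ` ({..<m} \<times> ?W (Suc n))) + card ((\<lambda>w. m # s # w) ` ?W n)"
    by (rule card_Un_le)
  also have "\<dots> \<le> card ({..<m} \<times> ?W (Suc n)) + card (?W n)"
    by (intro add_mono card_image_le) (auto simp: finite_marked_words)
  finally have "card (?W (Suc (Suc n))) \<le> m * card (?W (Suc n)) + card (?W n)"
    by (simp add: card_cartesian_product)
  then have "real (card (?W (Suc (Suc n)))) \<le> real m * real (card (?W (Suc n))) + real (card (?W n))"
    by (metis of_nat_add of_nat_le_iff of_nat_mult)
  also have "\<dots> \<le> real m * ?mu ^ Suc n + ?mu ^ n"
    using ge2 by (intro add_mono mult_left_mono) auto
  also have "\<dots> = ?mu ^ n * (real m * ?mu + 1)" by (simp add: algebra_simps)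
  also have "\<dots> \<le> ?mu ^ n * (?mu * ?mu)"
  proof (rule mult_left_mono)
    have "?mu * ?mu = real m * ?mu + 1 + (1 / real m) * (1 / real m)"
      using assms(1) by (simp add: algebra_simps)
    moreover have "0 \<le> (1 / real m) * (1 / real m)" by simp
    ultimately show "real m * ?mu + 1 \<le> ?mu * ?mu" by linarith
  qed simp
  finally show ?case by (simp only: power_Suc mult_ac)
qed

section \<open>Encoding avoiders by two color words\<close>

lemma finite_Av: "finite (Av k i n)"
  by (rule finite_subset[OF _ finite_permutations[of "{1..n}"]]) (auto simp: Av_def)

lemma card_Av_le:
  assumes "1 \<le> i" "i < k"
  shows "real (card (Av k i n)) \<le> ((real k - 1)\<^sup>2 + 1) ^ n"
proof -
  define m where "m = k - 1"
  have m: "0 < m" "i - 1 < m" using assms by (auto simp: m_def)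
  let ?c = "color k i n"
  \<comment> \<open>\<open>asc\<close> says that \<open>x\<close> and its right neighbour form an
    ascent of one color. \<open>U\<close> is the word of position colors with the letter
    \<open>m\<close> as a mark for this, and \<open>V\<close> is the word of value colors.\<close>
  define asc where "asc p x \<longleftrightarrow> x < n \<and> ?c p x = ?c p (Suc x) \<and> p x < p (Suc x)" for p x
  define U where "U p = map (\<lambda>x. if asc p x then m else ?c p x) [1..<Suc n]" for p
  define V where "V p = map (\<lambda>v. ?c p (inv p v)) [1..<Suc n]" for p
  \<comment> \<open>Two consecutive marks would produce an ascent of one color from \<open>x\<close>
    to \<open>x + 2\<close>, which \<open>same_color_ascent\<close> excludes.\<close>
  have asc: "?c p x = i - 1" "\<not> asc p (Suc x)"
    if "p \<in> Av k i n" "asc p x" "1 \<le> x" for p x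
  proof -
    have no: "\<not> contains_distant k i n p" using that by (simp add: Av_def)
    show "?c p x = i - 1"
      using same_color_ascent[OF assms no, of x "Suc x"] that by (auto simp: asc_def)
    show "\<not> asc p (Suc x)"
      using same_color_ascent[OF assms no, of x "Suc (Suc x)"] that by (auto simp: asc_def)
  qed
  \<comment> \<open>Inside a color class all pairs descend except the marked neighbours, so the
    marks decide every comparison.\<close>
  have ord: "p x < p y \<longleftrightarrow> (y < x \<and> \<not> (asc p y \<and> x = Suc y)) \<or> (asc p x \<and> y = Suc x)"
    if "p \<in> Av k i n" "x \<in> {1..n}" "y \<in> {1..n}" "?c p x = ?c p y" for p x y
  proof -
    have no: "\<not> contains_distant k i n p" and "p permutes {1..n}" using that by (simp_all add: Av_def)
    then have inj: "p x = p y \<Longrightarrow> x = y" using permutes_inj injD by metis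
    show ?thesis
    proof (cases x y rule: linorder_cases)
      case less
      then have "p x < p y \<longleftrightarrow> asc p x \<and> y = Suc x"
        using same_color_ascent[OF assms no, of x y] that unfolding asc_def by auto
      with less show ?thesis by auto
    next
      case greater
      then have "p y < p x \<longleftrightarrow> asc p y \<and> x = Suc y"
        using same_color_ascent[OF assms no, of y x] that unfolding asc_def by auto
      moreover have "p x < p y \<longleftrightarrow> \<not> p y < p x"
        using inj greater by (metis less_asym linorder_neqE_nat)
      ultimately show ?thesis using greater by auto
    qed simp
  qed
  have "inj_on (\<lambda>p. (U p, V p)) (Av k i n)"
  proof (rule inj_onI)
    fix p q assume p: "p \<in> Av k i n" and q: "q \<in> Av k i n" and "(U p, V p) = (U q, V q)"
    then have UV: "\<And>x. x \<in> {1..n} \<Longrightarrow> (if asc p x then m else ?c p x) = (if asc q x then m else ?c q x)"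
      "\<And>v. v \<in> {1..n} \<Longrightarrow> ?c p (inv p v) = ?c q (inv q v)"
      by (auto simp: U_def V_def simp del: upt_Suc)
    \<comment> \<open>Colors are smaller than \<open>m\<close>, so the marks can be read off the
      word.\<close>
    have as: "asc p x \<longleftrightarrow> asc q x" if "x \<in> {1..n}" for x
      using UV(1)[OF that] color_less[OF assms] unfolding m_def by (metis less_irrefl)
    \<comment> \<open>A mark only ever overwrites the color \<open>i - 1\<close>, so every color can
      be recovered.\<close>
    have co: "?c p x = ?c q x" if "x \<in> {1..n}" for x
      using UV(1)[OF that] as[OF that] asc(1)[OF p] asc(1)[OF q] that
      by (metis atLeastAtMost_iff)
    have perm: "p permutes {1..n}" "q permutes {1..n}" using p q by (simp_all add: Av_def)
    show "p = q"
    proof (rule permutes_eqI_of_coloring[OF perm, of "?c p"])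
      fix v assume v: "v \<in> {1..n}"
      then have "inv q v \<in> {1..n}" using permutes_in_image[OF permutes_inv[OF perm(2)]] by blast
      then show "?c p (inv p v) = ?c p (inv q v)" using UV(2)[OF v] co by metis
    next
      fix x y assume "x \<in> {1..n}" "y \<in> {1..n}" "?c p x = ?c p y"
      then show "p x < p y \<longleftrightarrow> q x < q y"
        using ord[OF p, of x y] ord[OF q, of x y] as[of x] as[of y] co[of x] co[of y] by auto
    qed simp
  qed
  moreover have "(\<lambda>p. (U p, V p)) ` Av k i n \<subseteq>
      marked_words m (i - 1) n \<times> {w. set w \<subseteq> {..<m} \<and> length w = n}"
  proof -
    have "U p \<in> marked_words m (i - 1) n" if p: "p \<in> Av k i n" for p
    proof -
      have nth: "U p ! x = (if asc p (Suc x) then m else ?c p (Suc x))" if "x < n" for x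
        using that by (simp add: U_def del: upt_Suc)
      have "U p ! Suc x = i - 1 \<and> Suc x < n" if "x < n" "U p ! x = m" for x
      proof -
        have a: "asc p (Suc x)" using that nth[of x] color_less[OF assms, of n p "Suc x"]
          by (auto simp: m_def split: if_splits)
        then have "Suc x < n" by (simp add: asc_def)
        moreover have "?c p (Suc (Suc x)) = i - 1"
          using a asc(1)[OF p a] by (simp add: asc_def)
        ultimately show ?thesis using asc(2)[OF p a] nth[of "Suc x"] by simp
      qed
      moreover have "set (U p) \<subseteq> {..m}"
        using color_less[OF assms, of n p] by (auto simp: U_def m_def less_imp_le)
      moreover have "length (U p) = n" by (simp add: U_def)
      ultimately show ?thesis unfolding marked_words_def by blast
    qed
    moreover have "set (V p) \<subseteq> {..<m} \<and> length (V p) = n" for p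
      using color_less[OF assms, of n p] by (auto simp: V_def m_def)
    ultimately show ?thesis by blast
  qed
  ultimately have "card (Av k i n) \<le> card (marked_words m (i - 1) n \<times> {w. set w \<subseteq> {..<m} \<and> length w = n})"
    by (intro card_inj_on_le) (auto simp: finite_marked_words finite_lists_length_eq)
  then have "card (Av k i n) \<le> card (marked_words m (i - 1) n) * m ^ n"
    by (simp add: card_cartesian_product card_lists_length_eq)
  then have "real (card (Av k i n)) \<le> real (card (marked_words m (i - 1) n)) * real m ^ n"
    by (metis of_nat_le_iff of_nat_mult of_nat_power)
  also have "\<dots> \<le> (real m + 1 / real m) ^ n * real m ^ n"
    using card_marked_words_le[OF m] by (intro mult_right_mono) auto
  also have "\<dots> = ((real m + 1 / real m) * real m) ^ n" by (simp only: power_mult_distrib)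
  also have "(real m + 1 / real m) * real m = (real m)\<^sup>2 + 1"
    using m by (simp add: distrib_right power2_eq_square)
  also have "real m = real k - 1" using assms by (simp add: m_def)
  finally show ?thesis .
qed

section \<open>Existence of the limit\<close>

text \<open>If B exceeded A, the powers of B/A would outgrow the constant A^d. This discards a
  bounded number of extra factors.\<close>

lemma power_bound_imp_le:
  fixes A B :: real
  assumes "0 < A" "0 < B" and le: "\<And>T. B ^ T \<le> A ^ (T + d)"
  shows "B \<le> A"
proof (rule ccontr)
  assume "\<not> B \<le> A"
  then have "1 < B / A" using assms by simp
  then obtain T where T: "A ^ d < (B / A) ^ T" using real_arch_pow by blast
  have "A ^ T * A ^ d < A ^ T * (B / A) ^ T" using T assms by (intro mult_strict_left_mono) auto
  also have "\<dots> = B ^ T" using assms by (simp flip: power_mult_distrib)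
  finally show False using le[of T] by (simp add: power_add)
qed

text \<open>Fekete's lemma: the limit is the supremum of the quotients, which also gives the bound
  for every single \<open>n\<close>.\<close>

lemma superadditive_limit:
  fixes f :: "nat \<Rightarrow> real" and C :: real
  assumes nonneg: "\<And>n. 0 \<le> f n" and super: "\<And>a b. f a + f b \<le> f (a + b)"
    and bound: "\<And>n. f n \<le> C * n"
  shows "\<exists>l. (\<lambda>n. f n / n) \<longlonglongrightarrow> l \<and> (\<forall>n. f n \<le> l * n)"
proof -
  define l where "l = (SUP n\<in>{1..}. f n / real n)"
  have bdd: "bdd_above ((\<lambda>n. f n / real n) ` {1..})"
    by (rule bdd_aboveI2[of _ _ C]) (use bound in \<open>auto simp: field_simps\<close>)
  have le: "f n / n \<le> l" if "n \<ge> 1" for n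
    unfolding l_def using that by (intro cSUP_upper bdd) auto
  have f0: "f 0 \<le> 0" using bound[of 0] by simp
  have mult: "real q * f N \<le> f (q * N)" for q N
  proof (induction q)
    case (Suc q)
    then show ?case using super[of N "q * N"] by (simp add: algebra_simps)
  qed (use nonneg in simp)
  have "(\<lambda>n. f n / n) \<longlonglongrightarrow> l"
  proof (rule order_tendstoI)
    \<comment> \<open>Some \<open>N\<close> already has quotient above \<open>a\<close>. Division n
      = q N + r gives f n \<ge> q f N \<ge> (n/N - 1) f N, so f n / n is at least f N / N - f N / n,
      and the last term vanishes.\<close>
    fix a assume "a < l"
    then obtain N where N: "N \<ge> 1" "a < f N / N"
      unfolding l_def by (subst (asm) less_cSUP_iff[OF _ bdd]) auto
    have "(\<lambda>n. f N / N - f N / real n) \<longlonglongrightarrow> f N / N - 0"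
      by (intro tendsto_diff tendsto_const lim_const_over_n)
    then have "\<forall>\<^sub>F n in sequentially. a < f N / N - f N / real n"
      using N by (intro order_tendstoD(1)) auto
    then show "\<forall>\<^sub>F n in sequentially. a < f n / n"
      using eventually_gt_at_top[of 0]
    proof eventually_elim
      case (elim n)
      define q where "q = n div N"
      have n: "n = q * N + n mod N" "n mod N < N" using N by (simp_all add: q_def)
      then have "n < q * N + N" by linarith
      then have "real n < real (q * N + N)" by (simp only: of_nat_less_iff)
      then have "real n < real q * N + N" by simp
      then have "real n / N < real q + 1" using N by (simp add: field_simps)
      then have "(real n / N - 1) * f N \<le> real q * f N"
        using nonneg by (intro mult_right_mono) auto
      also have "\<dots> \<le> f (q * N) + f (n mod N)" using mult[of q N] nonneg[of "n mod N"] by simp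
      also have "\<dots> \<le> f n" using super[of "q * N" "n mod N"] n(1) by simp
      finally have "(real n / N - 1) * f N / n \<le> f n / n" by (intro divide_right_mono) auto
      moreover have "(real n / N - 1) * f N / n = f N / N - f N / n"
        using elim(2) N by (simp add: field_simps)
      ultimately show ?case using elim(1) by simp
    qed
  next
    fix a assume "l < a"
    then show "\<forall>\<^sub>F n in sequentially. f n / n < a"
      using le by (intro eventually_sequentiallyI[of 1]) (rule le_less_trans)
  qed
  moreover have "f n \<le> l * n" for n
    using le[of n] f0 by (cases "n = 0") (auto simp: field_simps)
  ultimately show ?thesis by blast
qed

text \<open>Fekete's lemma applied to the logarithms. The bound by \<open>L ^ n\<close> is what
  later turns counts at special lengths into a lower bound for \<open>L\<close>.\<close>

lemma supermultiplicative_root_limit: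
  fixes a :: "nat \<Rightarrow> nat" and C :: real
  assumes pos: "\<And>n. 1 \<le> a n" and super: "\<And>s t. a s * a t \<le> a (s + t)"
    and C: "0 < C" "\<And>n. real (a n) \<le> C ^ n"
  shows "\<exists>L>0. (\<lambda>n. root n (a n)) \<longlonglongrightarrow> L \<and> (\<forall>n. real (a n) \<le> L ^ n)"
proof -
  have pos': "0 < real (a n)" for n using pos[of n] by simp
  have "\<exists>l. (\<lambda>n. ln (a n) / n) \<longlonglongrightarrow> l \<and> (\<forall>n. ln (a n) \<le> l * n)"
  proof (rule superadditive_limit)
    show "0 \<le> ln (real (a n))" for n using pos[of n] by simp
    show "ln (real (a s)) + ln (real (a t)) \<le> ln (real (a (s + t)))" for s t
    proof -
      have "real (a s) * real (a t) \<le> real (a (s + t))" using super[of s t] by (metis of_nat_le_iff of_nat_mult)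
      then have "ln (real (a s) * real (a t)) \<le> ln (real (a (s + t)))"
        using pos' by (subst ln_le_cancel_iff) (simp_all only: mult_pos_pos)
      then show ?thesis using pos'[of s] pos'[of t] by (simp add: ln_mult)
    qed
    show "ln (real (a n)) \<le> ln C * n" for n
    proof -
      have "ln (real (a n)) \<le> ln (C ^ n)" using C(2)[of n] pos'[of n] C(1) by simp
      then show ?thesis using C(1) by (simp add: ln_realpow mult.commute)
    qed
  qed
  then obtain l where l: "(\<lambda>n. ln (a n) / n) \<longlonglongrightarrow> l" "\<And>n. ln (a n) \<le> l * n" by blast
  have "(\<lambda>n. exp (ln (a n) / n)) \<longlonglongrightarrow> exp l" by (intro tendsto_exp l(1))
  moreover have "\<forall>\<^sub>F n in sequentially. exp (ln (a n) / n) = root n (a n)"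
    using eventually_gt_at_top[of 0]
  proof eventually_elim
    case (elim n)
    have "root n (a n) = exp (ln (root n (a n)))" using pos'[of n] elim by (simp add: real_root_gt_zero)
    then show ?case using pos'[of n] elim by (simp add: ln_root)
  qed
  ultimately have "(\<lambda>n. root n (a n)) \<longlonglongrightarrow> exp l" by (rule Lim_transform_eventually)
  moreover have "real (a n) \<le> exp l ^ n" for n
  proof -
    have "real (a n) = exp (ln (a n))" using pos'[of n] by simp
    also have "\<dots> \<le> exp (l * n)" using l(2) by simp
    also have "\<dots> = exp l ^ n" by (simp add: exp_of_nat_mult mult.commute flip: exp_of_nat2_mult)
    finally show ?thesis .
  qed
  ultimately show ?thesis by (intro exI[of _ "exp l"]) auto
qed

section \<open>Skew sums of avoiders\<close>

definition skew_sum :: "nat \<Rightarrow> nat \<Rightarrow> (nat \<Rightarrow> nat) \<Rightarrow> (nat \<Rightarrow> nat) \<Rightarrow> nat \<Rightarrow> nat" where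
  "skew_sum s t p q x = (if x \<in> {1..s} then p x + t else if x \<in> {s+1..s+t} then q (x - s) else x)"

lemma skew_sum_permutes:
  assumes p: "p permutes {1..s}" and q: "q permutes {1..t}"
  shows "skew_sum s t p q permutes {1..s+t}"
proof (rule bij_imp_permutes)
  have b1: "bij_betw (\<lambda>x. p x + t) {1..s} {t+1..s+t}"
  proof (rule bij_betw_trans[OF permutes_imp_bij[OF p], of "\<lambda>y. y + t", unfolded comp_def])
    show "bij_betw (\<lambda>y. y + t) {1..s} {t+1..s+t}"
      by (rule bij_betw_byWitness[of _ "\<lambda>y. y - t"]) auto
  qed
  have b2: "bij_betw (\<lambda>x. q (x - s)) {s+1..s+t} {1..t}"
  proof (rule bij_betw_trans[of "\<lambda>x. x - s" _ _ q, unfolded comp_def])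
    show "bij_betw (\<lambda>x. x - s) {s+1..s+t} {1..t}"
      by (rule bij_betw_byWitness[of _ "\<lambda>y. y + s"]) auto
  qed (rule permutes_imp_bij[OF q])
  have "bij_betw (\<lambda>x. if x \<in> {1..s} then p x + t else q (x - s))
      ({1..s} \<union> {s+1..s+t}) ({t+1..s+t} \<union> {1..t})"
    by (rule bij_betw_disjoint_Un[OF b1 b2]) auto
  moreover have "{1..s} \<union> {s+1..s+t} = {1..s+t}" "{t+1..s+t} \<union> {1..t} = {1..s+t}" by auto
  ultimately have "bij_betw (\<lambda>x. if x \<in> {1..s} then p x + t else q (x - s)) {1..s+t} {1..s+t}"
    by simp
  then show "bij_betw (skew_sum s t p q) {1..s+t} {1..s+t}"
    by (rule bij_betw_cong[THEN iffD1, rotated]) (auto simp: skew_sum_def)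
qed (auto simp: skew_sum_def)

text \<open>All values on the first \<open>s\<close> positions exceed all later ones, so an
  increasing subsequence stays in one block. A block is an interval of positions, so the gap
  survives the translation.\<close>

lemma skew_sum_Av:
  assumes p: "p \<in> Av k i s" and q: "q \<in> Av k i t" and "1 \<le> i" "i < k"
  shows "skew_sum s t p q \<in> Av k i (s + t)"
proof -
  let ?r = "skew_sum s t p q"
  have perm: "p permutes {1..s}" "q permutes {1..t}" using p q by (simp_all add: Av_def)
  have "\<not> contains_distant k i (s + t) ?r"
  proof
    assume "contains_distant k i (s + t) ?r"
    then obtain a where a: "\<And>j. j \<in> {1..k} \<Longrightarrow> a j \<in> {1..s + t}"
      "strict_mono_on {1..k} a" "strict_mono_on {1..k} (\<lambda>j. ?r (a j))" "a i + 2 \<le> a (i + 1)"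
      unfolding contains_distant_def by blast
    have "1 \<le> k" using assms by simp
    have le1: "a 1 \<le> a j" "?r (a 1) \<le> ?r (a j)" if "j \<in> {1..k}" for j
      using that a(2,3)[THEN strict_mono_on_leD, of 1 j] \<open>1 \<le> k\<close> by auto
    show False
    proof (cases "a 1 \<le> s")
      case True
      have r1: "t < ?r (a 1)"
        using True a(1)[of 1] \<open>1 \<le> k\<close> permutes_in_image[OF perm(1), of "a 1"] by (auto simp: skew_sum_def)
      have left: "a j \<in> {1..s}" if j: "j \<in> {1..k}" for j
      proof (rule ccontr)
        assume "a j \<notin> {1..s}"
        then have "a j \<in> {s+1..s+t}" using a(1)[OF j] by auto
        then have "?r (a j) \<le> t"
          using permutes_in_image[OF perm(2), of "a j - s"] by (auto simp: skew_sum_def)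
        with r1 le1(2)[OF j] show False by simp
      qed
      have "contains_distant k i s p"
        unfolding contains_distant_def
      proof (intro exI[of _ a] conjI)
        show "strict_mono_on {1..k} (\<lambda>j. p (a j))"
        proof (rule strict_mono_onI)
          fix u v assume uv: "u \<in> {1..k}" "v \<in> {1..k}" "u < v"
          then have "?r (a u) < ?r (a v)" using a(3) by (simp add: strict_mono_on_def)
          then show "p (a u) < p (a v)" using left[OF uv(1)] left[OF uv(2)] by (simp add: skew_sum_def)
        qed
      qed (use a left in auto)
      with p show False by (simp add: Av_def)
    next
      case False
      have right: "a j \<in> {s+1..s+t}" if j: "j \<in> {1..k}" for j
        using a(1)[OF j] le1(1)[OF j] False by auto
      have "contains_distant k i t q"
        unfolding contains_distant_def
      proof (intro exI[of _ "\<lambda>j. a j - s"] conjI)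
        show "(\<lambda>j. a j - s) \<in> {1..k} \<rightarrow> {1..t}" using right by fastforce
        show "strict_mono_on {1..k} (\<lambda>j. a j - s)"
        proof (rule strict_mono_onI)
          fix u v assume uv: "u \<in> {1..k}" "v \<in> {1..k}" "u < v"
          then have "a u < a v" using a(2) by (simp add: strict_mono_on_def)
          then show "a u - s < a v - s" using right[OF uv(1)] by auto
        qed
        show "strict_mono_on {1..k} (\<lambda>j. q (a j - s))"
        proof (rule strict_mono_onI)
          fix u v assume uv: "u \<in> {1..k}" "v \<in> {1..k}" "u < v"
          then have "?r (a u) < ?r (a v)" using a(3) by (simp add: strict_mono_on_def)
          then show "q (a u - s) < q (a v - s)"
            using right[OF uv(1)] right[OF uv(2)] by (simp add: skew_sum_def)
        qed
        show "a i - s + 2 \<le> a (i + 1) - s" using a(4) right[of i] assms(3,4) by auto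
      qed
      with q show False by (simp add: Av_def)
    qed
  qed
  then show ?thesis using skew_sum_permutes[OF perm] by (simp add: Av_def)
qed

lemma Av_supermultiplicative:
  assumes "1 \<le> i" "i < k"
  shows "card (Av k i s) * card (Av k i t) \<le> card (Av k i (s + t))"
proof -
  have "inj_on (\<lambda>(p, q). skew_sum s t p q) (Av k i s \<times> Av k i t)"
  proof (rule inj_onI, clarify)
    fix p q p' q'
    assume *: "p \<in> Av k i s" "q \<in> Av k i t" "p' \<in> Av k i s" "q' \<in> Av k i t"
      "skew_sum s t p q = skew_sum s t p' q'"
    have eq: "skew_sum s t p q x = skew_sum s t p' q' x" for x using *(5) by simp
    have "p x = p' x" for x
      using eq[of x] *(1-4) by (cases "x \<in> {1..s}") (auto simp: skew_sum_def Av_def permutes_not_in)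
    moreover have "q x = q' x" for x
      using eq[of "x + s"] *(1-4) by (cases "x \<in> {1..t}") (auto simp: skew_sum_def Av_def permutes_not_in)
    ultimately show "p = p' \<and> q = q'" by auto
  qed
  moreover have "(\<lambda>(p, q). skew_sum s t p q) ` (Av k i s \<times> Av k i t) \<subseteq> Av k i (s + t)"
    using skew_sum_Av assms by auto
  ultimately have "card (Av k i s \<times> Av k i t) \<le> card (Av k i (s + t))"
    by (rule card_inj_on_le) (rule finite_Av)
  then show ?thesis by (simp add: card_cartesian_product)
qed

text \<open>Since \<open>k\<close> is at least 2, the permutations of length 0 and 1 avoid the
  pattern; skew sums with a single entry then reach every length.\<close>

lemma card_Av_ge_1:
  assumes "1 \<le> i" "i < k"
  shows "1 \<le> card (Av k i n)"
proof -
  have one: "1 \<le> card (Av k i 1)"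
  proof -
    have "\<not> contains_distant k i 1 id"
    proof
      assume "contains_distant k i 1 id"
      then obtain a where a: "a \<in> {1..k} \<rightarrow> {1..1::nat}" "strict_mono_on {1..k} a"
        unfolding contains_distant_def by blast
      have "a 1 < a k" using assms by (intro strict_mono_onD[OF a(2)]) auto
      moreover have "a k \<le> 1" "1 \<le> a 1" using a(1) assms by (auto simp: Pi_iff)
      ultimately show False by simp
    qed
    then have "id \<in> Av k i 1" by (simp add: Av_def)
    then show ?thesis using finite_Av card_gt_0_iff by (metis One_nat_def Suc_leI empty_iff)
  qed
  show ?thesis
  proof (induction n)
    case 0
    have "\<not> contains_distant k i 0 id" using assms by (auto simp: contains_distant_def Pi_iff)
    then have "id \<in> Av k i 0" by (simp add: Av_def)
    then show ?case using finite_Av card_gt_0_iff by (metis One_nat_def Suc_leI empty_iff)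
  next
    case (Suc n)
    have "1 * 1 \<le> card (Av k i n) * card (Av k i 1)" using Suc one by (rule mult_le_mono)
    also have "\<dots> \<le> card (Av k i (n + 1))" by (rule Av_supermultiplicative[OF assms])
    finally show ?case by simp
  qed
qed

section \<open>Lower bound\<close>

definition pos :: "nat list \<Rightarrow> nat \<Rightarrow> nat \<times> nat" where
  "pos w x = (w ! x, count_list (take x w) (w ! x))"

lemma count_list_take_mono: "s \<le> t \<Longrightarrow> count_list (take s w) c \<le> count_list (take t w) c"
  by (metis count_list_append le_add1 take_add le_iff_add)

lemma count_list_take_Suc:
  "x < length w \<Longrightarrow> count_list (take (Suc x) w) c = count_list (take x w) c + (if w ! x = c then 1 else 0)"
  by (simp add: take_Suc_conv_app_nth)

lemma pos_less:
  assumes "x < y" "y < length w" "w ! x = w ! y"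
  shows "snd (pos w x) < snd (pos w y)"
  using count_list_take_mono[of "Suc x" y w "w ! y"] count_list_take_Suc[of x w "w ! y"] assms
  by (simp add: pos_def)

lemma pos_surj:
  "r < count_list w c \<Longrightarrow> \<exists>x<length w. pos w x = (c, r)"
proof (induction w rule: rev_induct)
  case (snoc a w)
  show ?case
  proof (cases "r < count_list w c")
    case True
    with snoc.IH obtain x where "x < length w" "pos w x = (c, r)" by blast
    then show ?thesis by (intro exI[of _ x]) (auto simp: pos_def nth_append)
  next
    case False
    with snoc.prems have "a = c" "r = count_list w c" by (auto split: if_splits)
    then show ?thesis by (intro exI[of _ "length w"]) (simp add: pos_def)
  qed
qed simp

definition ballot :: "nat \<Rightarrow> nat list \<Rightarrow> bool" where
  "ballot m w \<longleftrightarrow> (\<forall>t c c'. c < c' \<and> c' < m \<longrightarrow> count_list (take t w) c' \<le> count_list (take t w) c)"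

text \<open>These encode standard tableaux with \<open>m\<close> rows of length \<open>M\<close>:
  the letter at index \<open>x\<close> is the row of the corresponding entry, and
  \<open>pos w x\<close> is its cell, with rows and columns counted from 0.\<close>

definition ballot_words :: "nat \<Rightarrow> nat \<Rightarrow> nat list set" where
  "ballot_words m M = {w. set w \<subseteq> {..<m} \<and> (\<forall>c<m. count_list w c = M) \<and> ballot m w}"

lemma length_ballot_words: "w \<in> ballot_words m M \<Longrightarrow> length w = m * M"
  using sum_count_set[of w "{..<m}"] by (simp add: ballot_words_def)

text \<open>Columns of the tableau increase. The prefix ending with the letter \<open>c'\<close> of
  rank \<open>r\<close> contains \<open>r + 1\<close> letters \<open>c'\<close>, hence at least as
  many letters \<open>c\<close>, while only \<open>r\<close> letters \<open>c\<close> precede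
  \<open>z\<close>.\<close>

lemma ballot_pos_le:
  assumes "ballot m w" "c \<le> c'" "c' < m" "z < length w" "x < length w"
    and "pos w z = (c, r)" "pos w x = (c', r)"
  shows "z \<le> x"
proof (rule ccontr)
  assume "\<not> z \<le> x"
  have "Suc r = count_list (take (Suc x) w) c'"
    using count_list_take_Suc[of x w c'] assms by (auto simp: pos_def)
  also have "\<dots> \<le> count_list (take (Suc x) w) c"
    using assms(1-3) by (cases "c = c'") (auto simp: ballot_def)
  also have "\<dots> \<le> count_list (take z w) c"
    using \<open>\<not> z \<le> x\<close> by (intro count_list_take_mono) simp
  also have "\<dots> = r" using assms by (auto simp: pos_def)
  finally show False by simp
qed

lemma bij_betw_pos:
  assumes "w \<in> ballot_words m M"
  shows "bij_betw (pos w) {..<m * M} ({..<m} \<times> {..<M})"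
proof (rule bij_betw_imageI)
  have len: "length w = m * M" using assms by (rule length_ballot_words)
  show "inj_on (pos w) {..<m * M}"
  proof (rule linorder_inj_onI)
    fix x y assume "x < y" "x \<in> {..<m * M}" "y \<in> {..<m * M}"
    then show "pos w x \<noteq> pos w y"
      using pos_less[of x y w] len by (auto simp: pos_def)
  qed auto
  have "pos w x \<in> {..<m} \<times> {..<M}" if "x < m * M" for x
  proof -
    have x: "x < length w" using that len by simp
    then have c: "w ! x < m" using assms nth_mem[OF x] unfolding ballot_words_def by blast
    have "Suc (snd (pos w x)) \<le> count_list (take (length w) w) (w ! x)"
      using count_list_take_Suc[OF x, of "w ! x"] count_list_take_mono[of "Suc x" "length w" w "w ! x"] x
      by (simp add: pos_def)
    also have "\<dots> = M" using c assms by (simp add: ballot_words_def)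
    finally show ?thesis using c by (simp add: pos_def)
  qed
  moreover have "\<exists>x<m * M. pos w x = (c, r)" if "c < m" "r < M" for c r
    using pos_surj[of r w c] that assms len by (simp add: ballot_words_def)
  ultimately show "pos w ` {..<m * M} = {..<m} \<times> {..<M}"
    by (force simp: image_iff)
qed

text \<open>
  The \<open>r\<close>-th letter \<open>c\<close> of \<open>w\<close>, counted by position, is matched with the \<open>r\<close>-th letter \<open>m - 1 - c\<close> of
  \<open>w'\<close>, which is indexed by the values in decreasing order.  Equal letters then give decreasing
  subsequences, and the ballot property makes the entries of fixed rank \<open>r\<close> increase with \<open>c\<close>.
\<close>

definition linked :: "nat \<Rightarrow> nat list \<Rightarrow> nat list \<Rightarrow> (nat \<Rightarrow> nat) \<Rightarrow> bool" where
  "linked m w w' p \<longleftrightarrow> p permutes {1..length w} \<and>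
     (\<forall>x\<in>{1..length w}. pos w' (length w - p x) = (m - 1 - fst (pos w (x - 1)), snd (pos w (x - 1))))"

lemma linked_exists:
  assumes w: "w \<in> ballot_words m M" and w': "w' \<in> ballot_words m M"
  shows "\<exists>p. linked m w w' p"
proof -
  let ?n = "m * M" and ?G = "{..<m} \<times> {..<M}"
  let ?flip = "\<lambda>(c, r). (m - 1 - c, r :: nat)"
  let ?g = "the_inv_into {..<?n} (pos w')"
  have len: "length w = ?n" using w by (rule length_ballot_words)
  have b1: "bij_betw (\<lambda>x. x - 1) {1..?n} {..<?n}"
    by (rule bij_betw_byWitness[of _ Suc]) auto
  have b2: "bij_betw ?flip ?G ?G"
    by (rule bij_betw_byWitness[of _ ?flip]) auto
  have b3: "bij_betw ?g ?G {..<?n}"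
    by (rule bij_betw_the_inv_into[OF bij_betw_pos[OF w']])
  have b4: "bij_betw (\<lambda>y. ?n - y) {..<?n} {1..?n}"
    by (rule bij_betw_byWitness[of _ "\<lambda>y. ?n - y"]) auto
  \<comment> \<open>Read from right to left: position to index in \<open>w\<close>, index to cell,
    cell to cell in the reversed row, cell to index in \<open>w'\<close>, index to value.\<close>
  define f where "f = (\<lambda>y. ?n - y) \<circ> (?g \<circ> (?flip \<circ> (pos w \<circ> (\<lambda>x. x - 1))))"
  have f: "bij_betw f {1..?n} {1..?n}"
    unfolding f_def
    by (rule bij_betw_trans[OF bij_betw_trans[OF bij_betw_trans[OF bij_betw_trans[OF b1 bij_betw_pos[OF w]] b2] b3] b4])
  define p where "p x = (if x \<in> {1..?n} then f x else x)" for x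
  have "bij_betw p {1..?n} {1..?n}"
    using f by (rule bij_betw_cong[THEN iffD1, rotated]) (simp add: p_def)
  then have "p permutes {1..?n}"
    by (rule bij_imp_permutes) (auto simp: p_def)
  moreover have "pos w' (?n - p x) = ?flip (pos w (x - 1))" if x: "x \<in> {1..?n}" for x
  proof -
    have "x - 1 \<in> {..<?n}" using x by auto
    then have "pos w (x - 1) \<in> ?G" using bij_betwE[OF bij_betw_pos[OF w]] by blast
    then have G: "?flip (pos w (x - 1)) \<in> ?G" by (rule bij_betwE[OF b2, rule_format])
    then have "?g (?flip (pos w (x - 1))) < ?n" using bij_betwE[OF b3] by fastforce
    then have "?n - p x = ?g (?flip (pos w (x - 1)))" using x by (simp add: p_def f_def)
    then show ?thesis using f_the_inv_into_f_bij_betw[OF bij_betw_pos[OF w']] G by simp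
  qed
  ultimately show ?thesis unfolding linked_def len by (auto simp: case_prod_beta)
qed

section \<open>The permutation linked to a pair of ballot words\<close>

context
  fixes m M w w' p
  assumes w: "w \<in> ballot_words m M" and w': "w' \<in> ballot_words m M" and p: "linked m w w' p"
begin

lemma linked_facts:
  assumes "x \<in> {1..m * M}"
  shows "x - 1 < length w" "w ! (x - 1) < m" "m * M - p x < length w'" "1 \<le> p x" "p x \<le> m * M"
    "pos w' (m * M - p x) = (m - 1 - fst (pos w (x - 1)), snd (pos w (x - 1)))"
    "snd (pos w (x - 1)) < M"
proof -
  have len: "length w = m * M" "length w' = m * M" using w w' by (simp_all add: length_ballot_words)
  show "x - 1 < length w" using assms len by auto
  then have "x - 1 \<in> {..<m * M}" using len by simp
  from bij_betwE[OF bij_betw_pos[OF w], rule_format, OF this]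
  show "w ! (x - 1) < m" "snd (pos w (x - 1)) < M" by (auto simp: pos_def)
  have "p x \<in> {1..m * M}" using p assms len permutes_in_image unfolding linked_def by metis
  then show "1 \<le> p x" "p x \<le> m * M" "m * M - p x < length w'" using len by auto
  show "pos w' (m * M - p x) = (m - 1 - fst (pos w (x - 1)), snd (pos w (x - 1)))"
    using p assms len unfolding linked_def by simp
qed

text \<open>If the letter did not grow along the ascent, the ballot property of \<open>w\<close>
  would force the rank at \<open>x\<close> to be smaller than that at \<open>y\<close>, and the
  ballot property of \<open>w'\<close> would force the opposite.\<close>

lemma linked_ascent:
  assumes x: "x \<in> {1..m * M}" and y: "y \<in> {1..m * M}" and "x < y" "p x < p y"
  shows "w ! (x - 1) < w ! (y - 1)"
proof (rule ccontr)
  have bal: "ballot m w" "ballot m w'" using w w' by (simp_all add: ballot_words_def)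
  have cnt: "c < m \<Longrightarrow> count_list w c = M \<and> count_list w' c = M" for c
    using w w' by (simp add: ballot_words_def)
  obtain c2 r2 c r where pp: "pos w (x - 1) = (c2, r2)" "pos w (y - 1) = (c, r)" by fastforce
  note X = linked_facts[OF x] and Y = linked_facts[OF y]
  assume "\<not> w ! (x - 1) < w ! (y - 1)"
  then have c: "c \<le> c2" "c2 < m" "c < m" using pp X(2) Y(2) by (auto simp: pos_def)
  \<comment> \<open>\<open>z\<close> combines the letter of \<open>y\<close> with the rank of
    \<open>x\<close>. It comes no later than \<open>x\<close>, hence before
    \<open>y\<close>.\<close>
  obtain z where z: "z < length w" "pos w z = (c, r2)"
    using pos_surj[of r2 w c] cnt[OF c(3)] X(7) pp by auto
  have "z \<le> x - 1" by (rule ballot_pos_le[OF bal(1) c(1,2) z(1) X(1) z(2) pp(1)])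
  then have "z < y - 1" using \<open>x < y\<close> x by auto
  then have "r2 < r" using pos_less[of z "y - 1" w] Y(1) z(2) pp(2) by (auto simp: pos_def)
  \<comment> \<open>In \<open>w'\<close> the roles are exchanged: \<open>u\<close> combines the
    reversed letter of \<open>x\<close> with the rank of \<open>y\<close>. Indices in
    \<open>w'\<close> run against the values, so \<open>y\<close> precedes \<open>x\<close>
    there.\<close>
  obtain u where u: "u < length w'" "pos w' u = (m - 1 - c2, r)"
    using pos_surj[of r w' "m - 1 - c2"] cnt[of "m - 1 - c2"] c(2) Y(7) pp by auto
  have Y6: "pos w' (m * M - p y) = (m - 1 - c, r)" using Y(6) pp by simp
  have X6: "pos w' (m * M - p x) = (m - 1 - c2, r2)" using X(6) pp by simp
  have "u \<le> m * M - p y"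
    by (rule ballot_pos_le[OF bal(2) _ _ u(1) Y(3) u(2) Y6]) (use c in auto)
  also have "\<dots> < m * M - p x" using \<open>p x < p y\<close> Y by simp
  finally have "r < r2" using pos_less[of u "m * M - p x" w'] X(3) u(2) X6 by (auto simp: pos_def)
  with \<open>r2 < r\<close> show False by simp
qed

text \<open>The entry of the same rank with the preceding letter lies to the left by the ballot
  property of \<open>w\<close>, and lower by that of \<open>w'\<close>, where letters are reversed
  and indices run against values.\<close>

lemma linked_below:
  assumes y: "y \<in> {1..m * M}" and "0 < w ! (y - 1)"
  shows "\<exists>x. below p y x \<and> w ! (x - 1) = w ! (y - 1) - 1"
proof -
  have len: "length w = m * M" "length w' = m * M" using w w' by (simp_all add: length_ballot_words)
  have bal: "ballot m w" "ballot m w'" using w w' by (simp_all add: ballot_words_def)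
  obtain c r where pp: "pos w (y - 1) = (c, r)" by fastforce
  note Y = linked_facts[OF y]
  have c: "0 < c" "c < m" "w ! (y - 1) = c" using assms(2) Y(2) pp by (auto simp: pos_def)
  have "count_list w (c - 1) = M" using w c by (simp add: ballot_words_def)
  then obtain z where z: "z < length w" "pos w z = (c - 1, r)"
    using pos_surj[of r w "c - 1"] Y(7) pp by auto
  have "z \<le> y - 1" by (rule ballot_pos_le[OF bal(1) _ c(2) z(1) Y(1) z(2) pp]) simp
  moreover have "z \<noteq> y - 1" using z(2) pp c by auto
  ultimately have zy: "Suc z < y" by simp
  have x: "Suc z \<in> {1..m * M}" using z(1) len by simp
  note X = linked_facts[OF x]
  have X6: "pos w' (m * M - p (Suc z)) = (m - 1 - (c - 1), r)" using X(6) z by simp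
  have Y6: "pos w' (m * M - p y) = (m - 1 - c, r)" using Y(6) pp by simp
  have "m * M - p y \<le> m * M - p (Suc z)"
    by (rule ballot_pos_le[OF bal(2) _ _ Y(3) X(3) Y6 X6]) (use c in auto)
  moreover have "m * M - p y \<noteq> m * M - p (Suc z)" using X6 Y6 c by auto
  ultimately have "p (Suc z) < p y" using X Y by linarith
  with zy z(2) c(3) show ?thesis by (intro exI[of _ "Suc z"]) (simp add: below_def pos_def)
qed

text \<open>This recovers \<open>w\<close> from \<open>p\<close>.\<close>

lemma linked_chain:
  assumes "x \<in> {1..m * M}"
  shows "chain (below p) j x \<longleftrightarrow> j \<le> w ! (x - 1)"
  using assms
proof (induction j arbitrary: x)
  case (Suc j)
  show ?case
  proof
    \<comment> \<open>Each step of a chain lowers the letter by \<open>linked_ascent\<close>;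
      conversely \<open>linked_below\<close> supplies steps that lower it by exactly one.\<close>
    assume "chain (below p) (Suc j) x"
    then obtain z where z: "below p x z" "chain (below p) j z" by auto
    then have "z \<in> {1..m * M}" using Suc.prems by (auto simp: below_def)
    then show "Suc j \<le> w ! (x - 1)"
      using linked_ascent[of z x] z Suc.IH[of z] Suc.prems by (auto simp: below_def)
  next
    assume *: "Suc j \<le> w ! (x - 1)"
    then obtain z where z: "below p x z" "w ! (z - 1) = w ! (x - 1) - 1"
      using linked_below[OF Suc.prems] by auto
    then have "z \<in> {1..m * M}" using Suc.prems by (auto simp: below_def)
    then have "chain (below p) j z" using Suc.IH[of z] z * by simp
    then show "chain (below p) (Suc j) x" using z by auto
  qed
qed simp

text \<open>Letters strictly increase along an increasing subsequence and there are only
  \<open>m\<close> of them, so no increasing subsequence of length \<open>m + 1\<close>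
  exists.\<close>

lemma linked_Av: "p \<in> Av (Suc m) i (m * M)"
proof -
  have len: "length w = m * M" using w by (simp add: length_ballot_words)
  have "\<not> contains_distant (Suc m) i (m * M) p"
  proof
    assume "contains_distant (Suc m) i (m * M) p"
    then obtain a where a: "\<And>j. j \<in> {1..Suc m} \<Longrightarrow> a j \<in> {1..m * M}"
      "strict_mono_on {1..Suc m} a" "strict_mono_on {1..Suc m} (\<lambda>j. p (a j))"
      unfolding contains_distant_def by blast
    have "j \<le> m \<Longrightarrow> j \<le> w ! (a (Suc j) - 1)" for j
    proof (induction j)
      case (Suc j)
      have "w ! (a (Suc j) - 1) < w ! (a (Suc (Suc j)) - 1)"
        by (rule linked_ascent) (use a Suc.prems in \<open>auto simp: strict_mono_on_def\<close>)
      with Suc show ?case by simp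
    qed simp
    from this[of m] linked_facts(2)[OF a(1)[of "Suc m"]] show False by simp
  qed
  then show ?thesis using p len by (simp add: Av_def linked_def)
qed

end

text \<open>The letters of the first word are the heights in \<open>p\<close>. Once this word is
  known, \<open>linked\<close> prescribes the letter of the second word attached to each
  value.\<close>

lemma linked_unique:
  assumes w: "w1 \<in> ballot_words m M" "w1' \<in> ballot_words m M" "linked m w1 w1' p"
    and v: "w2 \<in> ballot_words m M" "w2' \<in> ballot_words m M" "linked m w2 w2' p"
  shows "w1 = w2 \<and> w1' = w2'"
proof
  have len: "length w1 = m * M" "length w2 = m * M" "length w1' = m * M" "length w2' = m * M"
    using w v by (simp_all add: length_ballot_words)
  show eq: "w1 = w2"
  proof (rule nth_equalityI)
    fix x assume "x < length w1"
    then have x: "Suc x \<in> {1..m * M}" using len by simp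
    show "w1 ! x = w2 ! x"
      using linked_chain[OF w x, of "w1 ! x"] linked_chain[OF v x, of "w1 ! x"]
        linked_chain[OF w x, of "w2 ! x"] linked_chain[OF v x, of "w2 ! x"] by simp
  qed (simp add: len)
  show "w1' = w2'"
  proof (rule nth_equalityI)
    fix y assume "y < length w1'"
    then have y: "m * M - y \<in> {1..m * M}" "y < m * M" using len by auto
    have perm: "p permutes {1..m * M}" using w(3) len by (simp add: linked_def)
    obtain x where x: "x \<in> {1..m * M}" "p x = m * M - y"
      using permutes_image[OF perm] y(1) by (metis imageE)
    show "w1' ! y = w2' ! y"
      using linked_facts(6)[OF w x(1)] linked_facts(6)[OF v x(1)] x(2) y(2) eq
      by (simp add: pos_def)
  qed (simp add: len)
qed

lemma card_ballot_words_le: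
  "card (ballot_words m M) ^ 2 \<le> card (Av (Suc m) i (m * M))"
proof -
  let ?B = "ballot_words m M"
  define f where "f = (\<lambda>(w, w'). SOME p. linked m w w' p)"
  have f: "linked m w w' (f (w, w'))" if "w \<in> ?B" "w' \<in> ?B" for w w'
    using someI_ex[OF linked_exists[OF that]] by (simp add: f_def)
  have "inj_on f (?B \<times> ?B)"
    by (rule inj_onI, clarify) (use f linked_unique in \<open>metis\<close>)
  moreover have "f ` (?B \<times> ?B) \<subseteq> Av (Suc m) i (m * M)"
    using f linked_Av by (auto simp: image_subset_iff)
  ultimately have "card (?B \<times> ?B) \<le> card (Av (Suc m) i (m * M))"
    by (rule card_inj_on_le) (rule finite_Av)
  then show ?thesis by (simp add: card_cartesian_product power2_eq_square)
qed

section \<open>Ballot words built from blocks with equal letter counts\<close>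

definition ramp :: "nat \<Rightarrow> (nat \<Rightarrow> nat) \<Rightarrow> nat list" where
  "ramp m f = concat (map (\<lambda>c. replicate (f c) c) [0..<m])"

lemma ramp_Suc: "ramp (Suc m) f = ramp m f @ replicate (f m) m"
  by (simp add: ramp_def)

lemma set_ramp: "set (ramp m f) \<subseteq> {..<m}"
  by (auto simp: ramp_def)

lemma count_list_replicate': "count_list (replicate n x) c = (if c = x then n else 0)"
  by (induction n) auto

lemma count_list_ramp: "count_list (ramp m f) c = (if c < m then f c else 0)"
proof (induction m)
  case 0 then show ?case by (simp add: ramp_def)
next
  case (Suc m)
  then show ?case by (auto simp: ramp_Suc count_list_replicate' less_Suc_eq)
qed

lemma sorted_ramp: "sorted (ramp m f)"
proof (induction m)
  case 0 then show ?case by (simp add: ramp_def)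
next
  case (Suc m)
  then show ?case using set_ramp[of m f] by (auto simp: ramp_Suc sorted_append less_imp_le)
qed

text \<open>Once a larger letter has appeared in a sorted word, no smaller one can follow.\<close>

lemma sorted_count_list_take:
  assumes "sorted w" "c < c'" "c' \<in> set (take t w)"
  shows "count_list (take t w) c = count_list w c"
proof -
  have s: "sorted (take t w @ drop t w)" using assms(1) by simp
  have "c \<notin> set (drop t w)"
    using s assms(2,3) unfolding sorted_append by fastforce
  then have "count_list (drop t w) c = 0" by (simp add: count_list_0_iff)
  moreover have "count_list w c = count_list (take t w) c + count_list (drop t w) c"
    by (metis append_take_drop_id count_list_append)
  ultimately show ?thesis by simp
qed

text \<open>Arrangements of a multiset, so that their number is available as a multinomial
  coefficient.\<close>

definition balanced :: "nat \<Rightarrow> nat \<Rightarrow> nat list set" where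
  "balanced m N = permutations_of_multiset (mset (ramp m (\<lambda>_. N)))"

lemma balancedD:
  assumes "b \<in> balanced m N"
  shows "set b \<subseteq> {..<m}" "c < m \<Longrightarrow> count_list b c = N" "length b = m * N"
proof -
  have ms: "mset b = mset (ramp m (\<lambda>_. N))"
    using assms by (simp add: balanced_def permutations_of_multiset_def)
  show s: "set b \<subseteq> {..<m}" using mset_eq_setD[OF ms] set_ramp by simp
  have c: "count_list b c = N" if "c < m" for c
    using ms count_list_ramp[of m "\<lambda>_. N" c] that by (metis count_mset)
  then show "c < m \<Longrightarrow> count_list b c = N" .
  show "length b = m * N" using sum_count_set[OF s] c by simp
qed

text \<open>Induction on \<open>N\<close>: the old correction \<open>(N * m) ^ m\<close> is absorbed
  by the \<open>m\<close> new factors of the factorial, each larger than \<open>m * N\<close>, and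
  the factor \<open>(Suc N * m) ^ m\<close> gained on the other side becomes the new
  correction.\<close>

lemma fact_mult_ge: "fact (m * N) * (N * m) ^ m \<ge> (fact N :: nat) ^ m * m ^ (m * N)" if "0 < N"
  using that
proof (induction N rule: nat_induct_non_zero)
  case 1
  show ?case by simp
next
  case (Suc N)
  have rise: "fact a * a ^ j \<le> (fact (a + j) :: nat)" for a j
  proof (induction j)
    case (Suc j)
    have "fact a * a ^ Suc j = a * (fact a * a ^ j)" by simp
    also have "\<dots> \<le> (a + Suc j) * fact (a + j)" using Suc by (intro mult_mono) auto
    finally show ?case by simp
  qed simp
  have "fact (Suc N) ^ m * m ^ (m * Suc N) = (fact N ^ m * m ^ (m * N)) * (Suc N * m) ^ m"
  proof -
    have "fact (Suc N) = Suc N * (fact N :: nat)" "m ^ (m * Suc N) = m ^ (m * N) * m ^ m"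
      by (simp_all add: power_add)
    then show ?thesis by (simp only: power_mult_distrib mult_ac)
  qed
  also have "\<dots> \<le> (fact (m * N) * (N * m) ^ m) * (Suc N * m) ^ m"
    using Suc.IH by (rule mult_right_mono) simp
  also have "\<dots> = (fact (m * N) * (m * N) ^ m) * (Suc N * m) ^ m" by (simp add: mult.commute)
  also have "\<dots> \<le> fact (m * N + m) * (Suc N * m) ^ m"
    by (intro mult_right_mono rise) simp
  finally show ?case by (simp add: add.commute)
qed

text \<open>The multinomial coefficient (mN)!/(N!)^m falls short of m^(mN) by a factor that is only
  polynomial in \<open>N\<close>, which will not affect the growth rate.\<close>

lemma card_balanced_ge:
  assumes "0 < N"
  shows "m ^ (m * N) \<le> card (balanced m N) * (N * m) ^ m"
proof -
  let ?M = "mset (ramp m (\<lambda>_. N))"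
  have set: "set_mset ?M = {..<m}"
  proof -
    have "c \<in># ?M \<longleftrightarrow> c < m" for c
      using count_list_ramp[of m "\<lambda>_. N" c] assms
      by (metis count_mset count_greater_zero_iff less_irrefl)
    then show ?thesis by auto
  qed
  have size: "size ?M = m * N"
    using sum_count_set[OF set_ramp, of m "\<lambda>_. N"] by (simp add: count_list_ramp)
  have "card (balanced m N) * fact N ^ m = fact (m * N)"
    using card_permutations_of_multiset_aux[of ?M] unfolding set size
    by (simp add: balanced_def count_mset count_list_ramp)
  then have "fact (m * N) * (N * m) ^ m = fact N ^ m * (card (balanced m N) * (N * m) ^ m)"
    by (metis mult.assoc mult.commute)
  then have "fact N ^ m * m ^ (m * N) \<le> fact N ^ m * (card (balanced m N) * (N * m) ^ m)"
    using fact_mult_ge[OF assms, of m] by (simp only:)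
  moreover have "0 < (fact N :: nat) ^ m" by simp
  ultimately show ?thesis by (simp only: mult_le_cancel1)
qed

lemma concat_balanced:
  assumes "set bs \<subseteq> balanced m N" "c < m"
  shows "count_list (concat bs) c = length bs * N"
  using assms by (induction bs) (auto simp: balancedD)

text \<open>At block boundaries all letters are level, and inside one block a letter gains at most
  \<open>N\<close>.\<close>

lemma concat_balanced_take:
  assumes "set bs \<subseteq> balanced m N" "c < m" "c' < m"
  shows "count_list (take t (concat bs)) c' \<le> count_list (take t (concat bs)) c + N"
  using assms(1)
proof (induction bs arbitrary: t)
  case (Cons b bs)
  have b: "count_list b c = N" "count_list b c' = N" using Cons.prems assms(2,3) by (auto simp: balancedD)
  show ?case
  proof (cases "t \<le> length b")
    case True
    have "count_list (take t b) c' \<le> count_list (take (length b) b) c'"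
      using True by (rule count_list_take_mono)
    then show ?thesis using True b by simp
  next
    case False
    then show ?thesis using Cons.IH[of "t - length b"] Cons.prems b by simp
  qed
qed simp

text \<open>The opening ramp gives each letter a lead of \<open>N\<close> over the next one, which
  covers every fluctuation inside the blocks. The closing ramp cancels these leads, so that all
  letters end level.\<close>

lemma ramp_concat_ballot:
  assumes bs: "set bs \<subseteq> balanced m N"
  shows "ramp m (\<lambda>c. (m - 1 - c) * N) @ concat bs @ ramp m (\<lambda>c. c * N)
    \<in> ballot_words m ((length bs + (m - 1)) * N)"
proof -
  let ?f = "\<lambda>c. (m - 1 - c) * N" and ?g = "\<lambda>c. c * N"
  let ?r = "ramp m ?f" and ?s = "ramp m ?g"
  let ?w = "?r @ concat bs @ ?s"
  have total: "count_list ?w c = (length bs + (m - 1)) * N" if "c < m" for c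
  proof -
    have "(m - 1 - c) * N + (length bs * N + c * N) = (m - 1 - c + length bs + c) * N"
      by (simp add: add_mult_distrib)
    also have "m - 1 - c + length bs + c = length bs + (m - 1)" using that by simp
    finally show ?thesis using that by (simp add: count_list_ramp concat_balanced[OF bs])
  qed
  have gap: "?f c' + N \<le> ?f c" if "c < c'" "c' < m" for c c'
  proof -
    have "(m - 1 - c' + 1) * N \<le> (m - 1 - c) * N" using that by (intro mult_right_mono) auto
    then show ?thesis by simp
  qed
  have "count_list (take t ?w) c' \<le> count_list (take t ?w) c" if cc: "c < c'" "c' < m" for t c c'
  proof -
    have cm: "c < m" using cc by simp
    let ?t1 = "take t ?r" and ?t2 = "take (t - length ?r) (concat bs)"
    let ?t3 = "take (t - length ?r - length (concat bs)) ?s"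
    \<comment> \<open>The prefix ends in the opening ramp, in the blocks, or in the closing ramp. In
      a ramp, once \<open>c'\<close> has appeared all copies of \<open>c\<close> are present; in the
      closing ramp \<open>c\<close> has then reached its final count, which \<open>c'\<close> cannot
      exceed.\<close>
    consider "t < length ?r" | "length ?r \<le> t" "t - length ?r < length (concat bs)"
      | "length ?r \<le> t" "length (concat bs) \<le> t - length ?r" by linarith
    then show ?thesis
    proof cases
      case 1
      then have eq: "take t ?w = ?t1" by simp
      have "count_list ?t1 c' \<le> count_list ?t1 c"
      proof (cases "c' \<in> set ?t1")
        case True
        have "count_list ?t1 c' \<le> count_list (take (length ?r) ?r) c'"
          using 1 by (intro count_list_take_mono) simp
        also have "\<dots> \<le> count_list ?r c" using cc add_leD1[OF gap[OF cc]] by (simp add: count_list_ramp)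
        also have "\<dots> = count_list ?t1 c"
          using sorted_count_list_take[OF sorted_ramp cc(1) True] by simp
        finally show ?thesis .
      qed simp
      then show ?thesis by (simp only: eq)
    next
      case 2
      then have "take t ?w = ?r @ ?t2" by simp
      then show ?thesis
        using concat_balanced_take[OF bs cm cc(2), of "t - length ?r"] gap[OF cc] cc
        by (simp add: count_list_ramp)
    next
      case 3
      then have eq: "take t ?w = ?r @ concat bs @ ?t3" by simp
      show ?thesis
      proof (cases "c' \<in> set ?t3")
        case True
        have full: "count_list (take t ?w) c = count_list ?w c"
          using sorted_count_list_take[OF sorted_ramp cc(1) True] unfolding eq by simp
        have "count_list (take t ?w) c' \<le> count_list ?w c'"
          by (metis append_take_drop_id count_list_append le_add1)
        then show ?thesis using full total[OF cm] total[OF cc(2)] by simp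
      next
        case False
        then have "count_list ?t3 c' = 0" by (simp add: count_list_0_iff)
        then show ?thesis
          unfolding eq using gap[OF cc] cc by (simp add: count_list_ramp concat_balanced[OF bs])
      qed
    qed
  qed
  moreover have "set ?w \<subseteq> {..<m}"
    using set_ramp[of m ?f] set_ramp[of m ?g] bs balancedD(1) by fastforce
  ultimately show ?thesis using total unfolding ballot_words_def ballot_def by blast
qed

lemma finite_ballot_words: "finite (ballot_words m M)"
proof (rule finite_subset)
  show "ballot_words m M \<subseteq> {w. set w \<subseteq> {..<m} \<and> length w = m * M}"
    using length_ballot_words by (auto simp: ballot_words_def)
qed (simp add: finite_lists_length_eq)

text \<open>All blocks have the common length \<open>m * N\<close>, so the concatenation can be cut
  back into its \<open>T\<close> blocks.\<close>

lemma card_ballot_words_ge: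
  "card (balanced m N) ^ T \<le> card (ballot_words m ((T + (m - 1)) * N))"
proof -
  let ?L = "{bs. set bs \<subseteq> balanced m N \<and> length bs = T}"
  let ?h = "\<lambda>bs. ramp m (\<lambda>c. (m - 1 - c) * N) @ concat bs @ ramp m (\<lambda>c. c * N)"
  have "inj_on ?h ?L"
  proof (rule inj_onI)
    fix bs bs' assume bs: "bs \<in> ?L" "bs' \<in> ?L" and "?h bs = ?h bs'"
    then have "concat bs = concat bs'" by simp
    then show "bs = bs'"
    proof (rule concat_injective)
      show "\<forall>(x, y)\<in>set (zip bs bs'). length x = length y"
        using bs by (auto elim!: in_set_zipE simp: subset_iff balancedD(3))
    qed (use bs in simp)
  qed
  moreover have "?h ` ?L \<subseteq> ballot_words m ((T + (m - 1)) * N)"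
    using ramp_concat_ballot by auto
  ultimately have "card ?L \<le> card (ballot_words m ((T + (m - 1)) * N))"
    by (rule card_inj_on_le) (rule finite_ballot_words)
  moreover have "finite (balanced m N)" by (simp add: balanced_def)
  ultimately show ?thesis by (simp add: card_lists_length_eq)
qed

text \<open>If \<open>L\<close> were below m^2, then \<open>L\<close> is (r m)^2 with r < 1.
  Comparing with the number of balanced words leaves 1 \<le> m N r^N for every positive
  \<open>N\<close>, although the right side tends to 0.\<close>

lemma growth_lower_bound:
  fixes L :: real
  assumes "0 < m" "0 < L" and L: "\<And>n. real (card (Av (Suc m) i n)) \<le> L ^ n"
  shows "(real m)\<^sup>2 \<le> L"
proof (rule ccontr)
  assume small: "\<not> (real m)\<^sup>2 \<le> L"
  define r where "r = sqrt L / real m"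
  have r: "0 < r" "r < 1" "L = (r * real m)\<^sup>2"
    using small assms(1,2) real_sqrt_less_mono[of L "(real m)\<^sup>2"] by (auto simp: r_def)
  have main: "1 \<le> real m * (real N * r ^ N)" if "0 < N" for N
  proof -
    let ?b = "real (card (balanced m N))"
    have "m ^ (m * N) \<le> card (balanced m N) * (N * m) ^ m"
      by (rule card_balanced_ge[OF that])
    then have b: "real m ^ (m * N) \<le> ?b * (real N * real m) ^ m"
      by (metis of_nat_le_iff of_nat_mult of_nat_power)
    have "0 < real m ^ (m * N)" using assms(1) by simp
    then have "0 < ?b * (real N * real m) ^ m" using b by (rule less_le_trans)
    then have "0 < ?b" by (metis mult_zero_left of_nat_0 of_nat_0_less_iff neq0_conv)
    have "?b\<^sup>2 \<le> L ^ (m * N)"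
    \<comment> \<open>With \<open>N\<close> fixed and \<open>T\<close> growing, the two ramps only
      contribute the constant \<open>m - 1\<close> to the number of blocks, so their cost
      disappears.\<close>
    proof (rule power_bound_imp_le)
      fix T
      have "(card (balanced m N) ^ T)\<^sup>2 \<le> (card (ballot_words m ((T + (m - 1)) * N)))\<^sup>2"
        by (intro power_mono card_ballot_words_ge) simp
      also have "\<dots> \<le> card (Av (Suc m) i (m * ((T + (m - 1)) * N)))"
        by (rule card_ballot_words_le)
      finally have "(?b ^ T)\<^sup>2 \<le> real (card (Av (Suc m) i (m * ((T + (m - 1)) * N))))"
        by (metis of_nat_le_iff of_nat_power)
      also have "\<dots> \<le> L ^ (m * ((T + (m - 1)) * N))" by (rule L)
      also have "m * ((T + (m - 1)) * N) = m * N * (T + (m - 1))" by simp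
      finally show "(?b\<^sup>2) ^ T \<le> (L ^ (m * N)) ^ (T + (m - 1))"
        by (simp only: power_mult[symmetric] mult.commute[of 2])
    qed (use \<open>0 < ?b\<close> \<open>0 < L\<close> in auto)
    then have "?b\<^sup>2 \<le> ((r * real m) ^ (m * N))\<^sup>2"
      unfolding r(3) by (simp only: power_mult[symmetric] mult.commute[of 2])
    then have "?b \<le> (r * real m) ^ (m * N)"
      by (rule power2_le_imp_le) (use r(1) in simp)
    \<comment> \<open>Combining both estimates for the number of balanced words makes m^(mN) cancel
      and leaves an \<open>m\<close>-th power.\<close>
    then have "real m ^ (m * N) \<le> (r * real m) ^ (m * N) * (real N * real m) ^ m"
      using b by (meson mult_right_mono of_nat_0_le_iff order_trans zero_le_mult_iff zero_le_power)
    also have "\<dots> = real m ^ (m * N) * (real m * (real N * r ^ N)) ^ m"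
      by (simp add: power_mult_distrib power_mult[of r m] mult_ac flip: power_mult)
    finally have "1 ^ m \<le> (real m * (real N * r ^ N)) ^ m" using assms(1) by simp
    then show ?thesis using assms(1) r(1) by (simp del: power_one)
  qed
  have "(\<lambda>N. real m * (real N * r ^ N)) \<longlonglongrightarrow> real m * 0"
    using r by (intro tendsto_mult_left powser_times_n_limit_0) simp
  then have "\<forall>\<^sub>F N in sequentially. real m * (real N * r ^ N) < 1"
    by (rule order_tendstoD) simp
  then obtain N where "0 < N" "real m * (real N * r ^ N) < 1"
    using eventually_happens'[OF sequentially_bot eventually_conj[OF eventually_gt_at_top[of 0]]]
    by blast
  with main[of N] show False by simp
qed

theorem corollary2p4:
  fixes k i :: nat
  assumes "k > 0" and "1 \<le> i" and "i \<le> k - 1"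
  shows "(\<lambda>n. root n (real (card (Av k i n)))) \<longlonglongrightarrow> growth_rate k i \<and>
         (real k - 1)^2 \<le> growth_rate k i \<and>
         growth_rate k i \<le> (real k - 1)^2 + 1"
proof -
  let ?a = "\<lambda>n. card (Av k i n)" and ?C = "(real k - 1)\<^sup>2 + 1"
  have ik: "1 \<le> i" "i < k" using assms by auto
  have C: "0 < ?C" by (simp add: add_nonneg_pos)
  obtain L where "0 < L" and lim: "(\<lambda>n. root n (?a n)) \<longlonglongrightarrow> L" and L: "\<And>n. real (?a n) \<le> L ^ n"
    using supermultiplicative_root_limit[of ?a ?C, OF card_Av_ge_1[OF ik]
      Av_supermultiplicative[OF ik] C card_Av_le[OF ik]] by blast
  \<comment> \<open>Convergence is what identifies the \<open>lim\<close> in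
    \<open>growth_rate\<close> with \<open>L\<close>.\<close>
  have rate: "growth_rate k i = L" unfolding growth_rate_def using lim by (rule limI)
  have "k = Suc (k - 1)" "0 < k - 1" using ik by auto
  then have "(real (k - 1))\<^sup>2 \<le> L"
    using growth_lower_bound[of "k - 1" L i] \<open>0 < L\<close> L by metis
  then have "(real k - 1)\<^sup>2 \<le> L" using ik by simp
  moreover have "L \<le> ?C"
  proof (rule LIMSEQ_le_const2[OF lim], intro exI[of _ 1] allI impI)
    fix n :: nat assume n: "1 \<le> n"
    have "root n (?a n) \<le> root n (?C ^ n)" using n card_Av_le[OF ik] by simp
    also have "\<dots> = ?C" using n C by (simp add: real_root_power_cancel)
    finally show "root n (?a n) \<le> ?C" .
  qed
  ultimately show ?thesis using lim unfolding rate by blast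
qed

end
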